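(* Let $T$ be a tree on $n$ vertices. Then $\operatorname{tr}(T)\le \operatorname{tr}(S_n)$, with equality if and only if $T=S_n$ (up to isomorphism).
   Context: Graphs are finite and simple. For a graph $X$, let $L=D-A$ be its Laplacian matrix, with spectral decomposition $L=\sum_\lambda \lambda E_\lambda$, where $\lambda$ runs over the distinct eigenvalues of $L$ and $E_\lambda$ is the orthogonal projection onto the $\lambda$-eigenspace. The average mixing matrix is $\widehat{M}=\sum_\lambda E_\lambda\circ E_\lambda$ ($\circ$ is the entrywise product), and the laziness of $X$ is $\operatorname{tr}(X):=\operatorname{tr}(\widehat M)=\sum_\lambda\sum_{u\in V(X)} ((E_\lambda)_{uu})^2$. $S_n$ denotes the star on $n$ vertices (one center adjacent to $n-1$ leaves). *)

theory Defs
  imports "HOL-Analysis.Analysis"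
begin

section \<open>Finite simple graphs\<close>

text \<open>A graph is an adjacency relation on a finite vertex type, so the number of vertices
  of a graph on \<open>'v\<close> is \<open>CARD('v)\<close>.\<close>

type_synonym 'v graph = "'v \<Rightarrow> 'v \<Rightarrow> bool"

definition simple_graph :: "'v graph \<Rightarrow> bool" where
  "simple_graph G \<longleftrightarrow> symp G \<and> irreflp G"

definition connected_graph :: "'v graph \<Rightarrow> bool" where
  "connected_graph G \<longleftrightarrow> (\<forall>u v. G\<^sup>*\<^sup>* u v)"

text \<open>A cycle is the list of its at least three distinct vertices in cyclic order.\<close>

definition is_cycle :: "'v graph \<Rightarrow> 'v list \<Rightarrow> bool" where
  "is_cycle G p \<longleftrightarrow>
     length p \<ge> 3 \<and> distinct p \<and> successively G p \<and> G (last p) (hd p)"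

definition is_tree :: "'v graph \<Rightarrow> bool" where
  "is_tree G \<longleftrightarrow> simple_graph G \<and> connected_graph G \<and> (\<nexists>p. is_cycle G p)"

definition star :: "'v \<Rightarrow> 'v graph" where
  "star c u v \<longleftrightarrow> u \<noteq> v \<and> (u = c \<or> v = c)"

definition graph_iso :: "'v graph \<Rightarrow> 'w graph \<Rightarrow> bool" where
  "graph_iso G H \<longleftrightarrow> (\<exists>f. bij f \<and> (\<forall>u v. G u v \<longleftrightarrow> H (f u) (f v)))"


section \<open>The Laplacian matrix\<close>

definition adjacency_matrix :: "'v::finite graph \<Rightarrow> real^'v^'v" where
  "adjacency_matrix G = (\<chi> u v. if G u v then 1 else 0)"

definition degree_matrix :: "'v::finite graph \<Rightarrow> real^'v^'v" where
  "degree_matrix G = (\<chi> u v. if u = v then real (card {w. G u w}) else 0)"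

definition laplacian :: "'v::finite graph \<Rightarrow> real^'v^'v" where
  "laplacian G = degree_matrix G - adjacency_matrix G"


section \<open>Eigenprojections\<close>

definition eigenspace :: "real^'v^'v \<Rightarrow> real \<Rightarrow> (real^'v::finite) set" where
  "eigenspace A l = {x. A *v x = l *\<^sub>R x}"

definition eigenvalues :: "real^'v^'v::finite \<Rightarrow> real set" where
  "eigenvalues A = {l. \<exists>x. x \<noteq> 0 \<and> A *v x = l *\<^sub>R x}"

definition orth_proj :: "'a::euclidean_space set \<Rightarrow> 'a \<Rightarrow> 'a" where
  "orth_proj S x = (THE y. y \<in> S \<and> (\<forall>w\<in>S. orthogonal (x - y) w))"

definition eigenprojection :: "real^'v^'v \<Rightarrow> real \<Rightarrow> real^'v^'v::finite" where
  "eigenprojection A l = matrix (orth_proj (eigenspace A l))"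


section \<open>Average mixing matrix and laziness\<close>

definition entrywise_product :: "real^'v^'v \<Rightarrow> real^'v^'v \<Rightarrow> real^'v^'v::finite" where
  "entrywise_product A B = (\<chi> u v. A $ u $ v * B $ u $ v)"

definition average_mixing_matrix :: "'v::finite graph \<Rightarrow> real^'v^'v" where
  "average_mixing_matrix G =
     (\<Sum>l\<in>eigenvalues (laplacian G).
        entrywise_product (eigenprojection (laplacian G) l) (eigenprojection (laplacian G) l))"

definition laziness :: "'v::finite graph \<Rightarrow> real" where
  "laziness G = trace (average_mixing_matrix G)"


section \<open>Well-definedness\<close>

text \<open>The description in \<^const>\<open>orth_proj\<close> is proper on subspaces, the projection is linear
  (so that \<^const>\<open>matrix\<close> represents it), and the sum over the eigenvalues is finite.\<close>

lemma orth_proj_unique: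
  fixes S :: "'a::euclidean_space set"
  assumes "subspace S" "y \<in> S" "z \<in> S"
    and "\<forall>w\<in>S. orthogonal (x - y) w" "\<forall>w\<in>S. orthogonal (x - z) w"
  shows "y = z"
proof -
  have "y - z \<in> S" using assms by (simp add: subspace_diff)
  then have "(x - y) \<bullet> (y - z) = 0" "(x - z) \<bullet> (y - z) = 0"
    using assms by (auto simp: orthogonal_def)
  then have "(y - z) \<bullet> (y - z) = 0" by (simp add: inner_diff_left)
  then show ?thesis by simp
qed

lemma orth_proj_works:
  fixes S :: "'a::euclidean_space set"
  assumes "subspace S"
  shows "orth_proj S x \<in> S \<and> (\<forall>w\<in>S. orthogonal (x - orth_proj S x) w)"
proof -
  obtain y z where "y \<in> span S" "\<And>w. w \<in> span S \<Longrightarrow> orthogonal z w" "x = y + z"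
    using orthogonal_subspace_decomp_exists[of S x] by blast
  then have y: "y \<in> S \<and> (\<forall>w\<in>S. orthogonal (x - y) w)"
    using assms by (simp add: span_eq_iff[THEN iffD2])
  show ?thesis unfolding orth_proj_def
    by (rule theI[of _ y]) (use y orth_proj_unique[OF assms] in blast)+
qed

lemma orth_proj_eqI:
  fixes S :: "'a::euclidean_space set"
  assumes "subspace S" "y \<in> S" "\<And>w. w \<in> S \<Longrightarrow> orthogonal (x - y) w"
  shows "orth_proj S x = y"
  using orth_proj_unique[OF assms(1)] orth_proj_works[OF assms(1), of x] assms(2,3) by blast

lemma linear_orth_proj:
  fixes S :: "'a::euclidean_space set"
  assumes S: "subspace S"
  shows "linear (orth_proj S)"
proof (rule linearI)
  fix x y :: 'a and r :: real
  note w = orth_proj_works[OF S]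
  show "orth_proj S (x + y) = orth_proj S x + orth_proj S y"
  proof (rule orth_proj_eqI[OF S])
    show "orth_proj S x + orth_proj S y \<in> S" using w S by (simp add: subspace_add)
    fix v assume "v \<in> S"
    then have "orthogonal (x - orth_proj S x) v" "orthogonal (y - orth_proj S y) v"
      using w by auto
    then show "orthogonal (x + y - (orth_proj S x + orth_proj S y)) v"
      by (simp add: orthogonal_def inner_diff_left inner_add_left)
  qed
  show "orth_proj S (r *\<^sub>R x) = r *\<^sub>R orth_proj S x"
  proof (rule orth_proj_eqI[OF S])
    show "r *\<^sub>R orth_proj S x \<in> S" using w S by (simp add: subspace_scale)
    fix v assume "v \<in> S"
    then have "orthogonal (x - orth_proj S x) v" using w by auto
    then show "orthogonal (r *\<^sub>R x - r *\<^sub>R orth_proj S x) v"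
      by (simp add: orthogonal_def inner_diff_left)
  qed
qed

lemma subspace_eigenspace: "subspace (eigenspace A l)"
  unfolding eigenspace_def subspace_def
  by (simp add: matrix_vector_right_distrib matrix_vector_mult_scaleR scaleR_right_distrib
      mult.commute)

lemma eigenprojection_mult:
  "eigenprojection A l *v x = orth_proj (eigenspace A l) x"
  unfolding eigenprojection_def
  by (rule matrix_works)
    (use linear_orth_proj[OF subspace_eigenspace[of A l]] in
      \<open>simp add: linear_matrix_vector_mul_eq\<close>)

lemma transpose_laplacian:
  assumes "simple_graph G"
  shows "transpose (laplacian G) = laplacian G"
  using assms
  by (auto simp: simple_graph_def laplacian_def degree_matrix_def adjacency_matrix_def
      transpose_def vec_eq_iff dest: sympD)

lemma finite_eigenvalues:
  fixes A :: "real^'v::finite^'v"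
  assumes A: "transpose A = A"
  shows "finite (eigenvalues A)"
proof -
  define f where "f l = (SOME x. x \<noteq> 0 \<and> A *v x = l *\<^sub>R x)" for l
  have f: "f l \<noteq> 0 \<and> A *v f l = l *\<^sub>R f l" if "l \<in> eigenvalues A" for l
    unfolding f_def by (rule someI_ex) (use that in \<open>simp add: eigenvalues_def\<close>)
  have orth: "orthogonal (f l) (f m)"
    if "l \<in> eigenvalues A" "m \<in> eigenvalues A" "l \<noteq> m" for l m
  proof -
    have "(A *v f l) \<bullet> f m = f l \<bullet> (A *v f m)"
      by (metis A dot_lmul_matrix transpose_matrix_vector)
    then show ?thesis using f that by (simp add: orthogonal_def)
  qed
  have inj: "inj_on f (eigenvalues A)"
    by (rule inj_onI) (metis f orth orthogonal_self)
  have "pairwise orthogonal (f ` eigenvalues A)"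
    unfolding pairwise_def using orth by force
  then have "finite (f ` eigenvalues A)"
    by (rule pairwise_orthogonal_imp_finite)
  then show ?thesis using inj finite_imageD by blast
qed

lemma laziness_eq_sum:
  "laziness G = (\<Sum>l\<in>eigenvalues (laplacian G). \<Sum>u\<in>UNIV.
     (eigenprojection (laplacian G) l $ u $ u)\<^sup>2)"
  by (simp add: laziness_def average_mixing_matrix_def trace_def entrywise_product_def
      power2_eq_square sum.swap[of _ UNIV])

end

theory Submission
  imports Defs
begin

text \<open>For each nonzero eigenvalue of a connected graph, the diagonal of the eigenprojection has
  entries in \<open>[0, 1 - 1/n]\<close> and integer sum \<open>k\<close>. Since \<open>k\<close> is not a multiple of \<open>1 - 1/n\<close> unless
  \<open>k \<in> {0, n - 1}\<close>, not all the entries can be extreme, and by concavity the eigenvalue loses at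
  least \<open>k (n - 1 - k) / n\<^sup>2 \<ge> (n - 2) / n\<^sup>2\<close> against the bound \<open>(1 - 1/n) k\<close> for the sum of squares
  of the entries. A tree that is not a star has two vertices at distance three, hence at least
  three nonzero eigenvalues, and the total loss \<open>3 (n - 2) / n\<^sup>2\<close> exceeds the loss
  \<open>2 (n - 2) / (n (n - 1))\<close> of the star.\<close>

section \<open>The spectral theorem\<close>

lemma symmetric_inner_matrix:
  fixes A :: "real^'v::finite^'v"
  assumes "transpose A = A"
  shows "(A *v x) \<bullet> y = x \<bullet> (A *v y)"
  by (metis assms dot_lmul_matrix transpose_matrix_vector)

lemma eigenspaces_orthogonal:
  fixes A :: "real^'v::finite^'v"
  assumes "transpose A = A" "x \<in> eigenspace A l" "y \<in> eigenspace A m" "l \<noteq> m"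
  shows "x \<bullet> y = 0"
  using symmetric_inner_matrix[OF assms(1), of x y] assms(2-4)
  by (simp add: eigenspace_def)

text \<open>The maximizer \<open>x\<close> of the quadratic form on the unit sphere of
  \<open>W\<close> is an eigenvector: otherwise moving it along the residual
  \<open>A *v x - m *\<^sub>R x\<close>, which stays in \<open>W\<close> by invariance, would beat
  the maximum.\<close>

lemma invariant_subspace_has_eigenvector:
  fixes A :: "real^'v::finite^'v"
  assumes sym: "transpose A = A" and W: "subspace W"
    and inv: "\<And>w. w \<in> W \<Longrightarrow> A *v w \<in> W" and "y \<in> W" "y \<noteq> 0"
  obtains x l where "x \<in> W" "x \<noteq> 0" "x \<in> eigenspace A l"
proof -
  let ?S = "W \<inter> sphere 0 1"
  have "compact ?S"
    by (simp add: W closed_Int_compact closed_subspace)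
  moreover have "(1 / norm y) *\<^sub>R y \<in> ?S"
    using assms(4,5) W by (simp add: subspace_scale)
  moreover have "continuous_on ?S (\<lambda>x. x \<bullet> (A *v x))"
    by (intro continuous_intros matrix_vector_mult_linear_continuous_on)
  ultimately obtain x where x: "x \<in> ?S" and max: "\<And>y. y \<in> ?S \<Longrightarrow> y \<bullet> (A *v y) \<le> x \<bullet> (A *v x)"
    using continuous_attains_sup[of ?S "\<lambda>x. x \<bullet> (A *v x)"] by blast
  define m where "m = x \<bullet> (A *v x)"
  have xx: "x \<bullet> x = 1" using x by (simp add: dot_square_norm)
  have rayleigh: "y \<bullet> (A *v y) \<le> m * (y \<bullet> y)" if "y \<in> W" for y
  proof (cases "y = 0")
    case False
    let ?z = "(1 / norm y) *\<^sub>R y"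
    have "?z \<bullet> (A *v ?z) \<le> m"
      unfolding m_def using False that W by (intro max) (simp add: subspace_scale)
    moreover have "?z \<bullet> (A *v ?z) = (y \<bullet> (A *v y)) / (y \<bullet> y)"
      by (simp add: matrix_vector_mult_scaleR dot_square_norm power2_eq_square)
    ultimately have "(y \<bullet> (A *v y)) / (y \<bullet> y) \<le> m" by metis
    then show ?thesis using False by (simp add: pos_divide_le_eq)
  qed simp
  define w where "w = A *v x - m *\<^sub>R x"
  have wW: "w \<in> W" unfolding w_def using x W inv by (simp add: subspace_diff subspace_scale)
  define C where "C = m * (w \<bullet> w) - w \<bullet> (A *v w)"
  \<comment> \<open>This is \<open>rayleigh\<close> at \<open>x + t *\<^sub>R w\<close>, sorted by
    powers of \<open>t\<close>: the constants cancel, the linear part is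
    \<open>2 * t * (w \<bullet> w)\<close>, and \<open>C\<close> collects the quadratic
    part.\<close>
  have key: "2 * t * (w \<bullet> w) \<le> t\<^sup>2 * C" for t
  proof -
    have "x + t *\<^sub>R w \<in> W" using x wW W by (simp add: subspace_add subspace_scale)
    from rayleigh[OF this] have
      "(x + t *\<^sub>R w) \<bullet> (A *v (x + t *\<^sub>R w)) \<le> m * ((x + t *\<^sub>R w) \<bullet> (x + t *\<^sub>R w))" .
    moreover have "x \<bullet> (A *v w) = w \<bullet> (A *v x)"
      using symmetric_inner_matrix[OF sym, of x w] by (simp add: inner_commute)
    then have "(x + t *\<^sub>R w) \<bullet> (A *v (x + t *\<^sub>R w))
        = m + 2 * t * (w \<bullet> (A *v x)) + t\<^sup>2 * (w \<bullet> (A *v w))"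
      by (simp add: matrix_vector_right_distrib matrix_vector_mult_scaleR inner_add_left
          inner_add_right m_def power2_eq_square distrib_left)
    moreover have "(x + t *\<^sub>R w) \<bullet> (x + t *\<^sub>R w) = 1 + 2 * t * (w \<bullet> x) + t\<^sup>2 * (w \<bullet> w)"
      by (simp add: inner_add_left inner_add_right inner_commute[of x w] xx power2_eq_square
          distrib_left)
    ultimately have "m + 2 * t * (w \<bullet> (A *v x)) + t\<^sup>2 * (w \<bullet> (A *v w))
        \<le> m * (1 + 2 * t * (w \<bullet> x) + t\<^sup>2 * (w \<bullet> w))" by metis
    moreover have "w \<bullet> w = w \<bullet> (A *v x) - m * (w \<bullet> x)"
      by (subst (2) w_def) (simp add: inner_diff_right)
    then have "2 * t * (w \<bullet> w) = 2 * t * (w \<bullet> (A *v x)) - m * (2 * t * (w \<bullet> x))"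
      by (simp add: right_diff_distrib)
    ultimately show ?thesis by (simp add: C_def distrib_left right_diff_distrib mult.left_commute[of m])
  qed
  have "w \<bullet> w = 0"
  proof (rule ccontr)
    assume "w \<bullet> w \<noteq> 0"
    then have pos: "w \<bullet> w > 0" by simp
    \<comment> \<open>Small enough that \<open>t * C \<le> w \<bullet> w\<close>, while
      \<open>key\<close> divided by \<open>t\<close> demands
      \<open>2 * (w \<bullet> w) \<le> t * C\<close>. The added 1 keeps the denominator positive
      when \<open>C = 0\<close>.\<close>
    define t where "t = (w \<bullet> w) / (\<bar>C\<bar> + 1)"
    have t: "t > 0" "t * (\<bar>C\<bar> + 1) = w \<bullet> w" using pos by (auto simp: t_def add_nonneg_pos)
    have "t * C \<le> w \<bullet> w" using t by (smt (verit) mult_left_mono)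
    moreover have "2 * (w \<bullet> w) \<le> t * C"
      using key[of t] t(1) by (simp add: power2_eq_square algebra_simps)
    ultimately show False using pos by simp
  qed
  then have "x \<in> eigenspace A m" by (simp add: w_def eigenspace_def)
  moreover have "x \<noteq> 0" using xx by auto
  ultimately show thesis using that x by blast
qed

text \<open>What the projections miss of \<open>x\<close> lies in the common orthogonal complement
  \<open>W\<close> of all eigenspaces. \<open>W\<close> is invariant under \<open>A\<close>, so if
  it were nonzero it would contain an eigenvector, which would be orthogonal to itself.\<close>

lemma eigenprojections_sum:
  fixes A :: "real^'v::finite^'v"
  assumes sym: "transpose A = A"
  shows "(\<Sum>l\<in>eigenvalues A. eigenprojection A l *v x) = x"
proof (rule ccontr)
  let ?P = "\<lambda>l. orth_proj (eigenspace A l) x"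
  note works = orth_proj_works[OF subspace_eigenspace, of A _ x]
  define y where "y = x - (\<Sum>l\<in>eigenvalues A. ?P l)"
  assume "(\<Sum>l\<in>eigenvalues A. eigenprojection A l *v x) \<noteq> x"
  then have "y \<noteq> 0" by (auto simp: y_def eigenprojection_mult)
  define W where "W = {y. \<forall>l. \<forall>w\<in>eigenspace A l. y \<bullet> w = 0}"
  have "y \<bullet> w = 0" if w: "w \<in> eigenspace A m" for w m
  proof (cases "w = 0")
    case False
    then have m: "m \<in> eigenvalues A" using w by (auto simp: eigenspace_def eigenvalues_def)
    have "(\<Sum>l\<in>eigenvalues A. ?P l \<bullet> w) = (\<Sum>l\<in>eigenvalues A. if l = m then ?P m \<bullet> w else 0)"
      using eigenspaces_orthogonal[OF sym _ w] works by (intro sum.cong) auto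
    also have "\<dots> = ?P m \<bullet> w" using m finite_eigenvalues[OF sym] by simp
    finally show ?thesis
      using works[of m] w by (simp add: y_def inner_diff_left inner_sum_left orthogonal_def)
  qed simp
  then have "y \<in> W" by (simp add: W_def)
  moreover have "subspace W" by (auto simp: W_def subspace_def inner_add_left)
  moreover have "A *v w \<in> W" if "w \<in> W" for w
    using that symmetric_inner_matrix[OF sym, of w] by (auto simp: W_def eigenspace_def)
  ultimately obtain z l where "z \<in> W" "z \<noteq> 0" "z \<in> eigenspace A l"
    using invariant_subspace_has_eigenvector[OF sym] \<open>y \<noteq> 0\<close> by metis
  then show False unfolding W_def by (metis (mono_tags, lifting) inner_eq_zero_iff mem_Collect_eq)
qed

section \<open>Diagonal entries of the eigenprojections\<close>

lemma eigenprojection_diag: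
  "eigenprojection A l $ u $ u = orth_proj (eigenspace A l) (axis u 1) $ u"
  by (simp add: matrix_vector_mult_basis column_def flip: eigenprojection_mult)

text \<open>The entry is the squared norm of the projected basis vector, because the projection
  error is orthogonal to the projection.\<close>

lemma eigenprojection_diag_nonneg: "0 \<le> eigenprojection A l $ u $ u"
proof -
  let ?p = "orth_proj (eigenspace A l) (axis u 1)"
  have "(axis u 1 - ?p) \<bullet> ?p = 0"
    using orth_proj_works[OF subspace_eigenspace, of A l "axis u 1"] by (simp add: orthogonal_def)
  then have "?p $ u = ?p \<bullet> ?p"
    by (simp add: inner_diff_left inner_axis')
  then show ?thesis by (simp add: eigenprojection_diag)
qed

lemma eigenprojection_diag_sum:
  fixes A :: "real^'v::finite^'v"
  assumes "transpose A = A"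
  shows "(\<Sum>l\<in>eigenvalues A. eigenprojection A l $ u $ u) = 1"
proof -
  have "(\<Sum>l\<in>eigenvalues A. eigenprojection A l $ u $ u)
      = (\<Sum>l\<in>eigenvalues A. eigenprojection A l *v axis u 1) $ u"
    by (simp add: eigenprojection_diag eigenprojection_mult)
  also have "\<dots> = 1" by (simp add: eigenprojections_sum[OF assms])
  finally show ?thesis .
qed

text \<open>Supplies the integrality on which the loss estimate rests. In an orthonormal basis of
  the eigenspace the diagonal entries are sums of squared coordinates, and each basis vector
  contributes its norm 1.\<close>

lemma trace_eigenprojection:
  fixes A :: "real^'v::finite^'v"
  shows "(\<Sum>u\<in>UNIV. eigenprojection A l $ u $ u) = real (dim (eigenspace A l))"
proof -
  obtain B where B: "B \<subseteq> eigenspace A l" "pairwise orthogonal B" "\<And>x. x \<in> B \<Longrightarrow> norm x = 1"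
    "independent B" "card B = dim (eigenspace A l)" "span B = eigenspace A l"
    using orthonormal_basis_subspace[OF subspace_eigenspace] by metis
  have fin: "finite B" using B(4) by (rule independent_imp_finite)
  have proj: "orth_proj (eigenspace A l) x = (\<Sum>b\<in>B. (x \<bullet> b) *\<^sub>R b)" for x
  proof (rule orth_proj_eqI[OF subspace_eigenspace])
    show "(\<Sum>b\<in>B. (x \<bullet> b) *\<^sub>R b) \<in> eigenspace A l"
      using B(1) by (intro subspace_sum subspace_eigenspace subspace_scale) auto
    fix w assume w: "w \<in> eigenspace A l"
    have "orthogonal (x - (\<Sum>b\<in>B. (x \<bullet> b) *\<^sub>R b)) c" if c: "c \<in> B" for c
    proof -
      have "(\<Sum>b\<in>B. (x \<bullet> b) * (b \<bullet> c)) = (\<Sum>b\<in>B. if b = c then x \<bullet> c else 0)"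
        using B(2,3) c by (intro sum.cong) (auto simp: pairwise_def orthogonal_def dot_square_norm)
      then show ?thesis
        using c fin by (simp add: orthogonal_def inner_diff_left inner_sum_left)
    qed
    then show "orthogonal (x - (\<Sum>b\<in>B. (x \<bullet> b) *\<^sub>R b)) w"
      using w B(6) by (intro orthogonal_to_span[of w B]) auto
  qed
  have "(\<Sum>u\<in>UNIV. eigenprojection A l $ u $ u) = (\<Sum>u\<in>UNIV. \<Sum>b\<in>B. (b $ u)\<^sup>2)"
    by (simp add: eigenprojection_diag proj inner_axis' power2_eq_square)
  also have "\<dots> = (\<Sum>b\<in>B. b \<bullet> b)"
    by (subst sum.swap) (simp add: inner_vec_def power2_eq_square)
  also have "\<dots> = real (card B)" using B(3) by (simp add: dot_square_norm)
  finally show ?thesis using B(5) by simp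
qed

lemma dim_eigenspace_pos:
  assumes "l \<in> eigenvalues A"
  shows "0 < dim (eigenspace A l)"
  using assms by (auto simp: eigenvalues_def eigenspace_def dim_eq_0 simp flip: neq0_conv)

lemma eigenprojection_diag_line:
  fixes A :: "real^'v::finite^'v"
  assumes "eigenspace A l = span {z}" "z \<noteq> 0"
  shows "eigenprojection A l $ u $ u = (z $ u)\<^sup>2 / (z \<bullet> z)"
proof -
  have "orth_proj (eigenspace A l) (axis u 1) = (z $ u / (z \<bullet> z)) *\<^sub>R z"
  proof (rule orth_proj_eqI[OF subspace_eigenspace])
    show "(z $ u / (z \<bullet> z)) *\<^sub>R z \<in> eigenspace A l"
      by (simp add: assms span_mul span_base)
    fix w assume "w \<in> eigenspace A l"
    then show "orthogonal (axis u 1 - (z $ u / (z \<bullet> z)) *\<^sub>R z) w"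
      using assms by (auto simp: span_singleton orthogonal_def inner_diff_left inner_axis')
  qed
  then show ?thesis by (simp add: eigenprojection_diag power2_eq_square)
qed

lemma eigenprojection_diag_non_eigenvalue:
  assumes "l \<notin> eigenvalues A"
  shows "eigenprojection A l $ u $ u = 0"
proof -
  have "orth_proj (eigenspace A l) (axis u 1) \<in> eigenspace A l"
    using orth_proj_works[OF subspace_eigenspace] by blast
  then have "orth_proj (eigenspace A l) (axis u 1) = 0"
    using assms by (auto simp: eigenspace_def eigenvalues_def)
  then show ?thesis by (simp add: eigenprojection_diag)
qed

text \<open>Allows summing over a list of candidate eigenvalues without deciding which of them
  occur.\<close>

lemma laziness_eq_sum_superset:
  fixes G :: "'v::finite graph"
  assumes "finite F" "eigenvalues (laplacian G) \<subseteq> F"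
  shows "laziness G = (\<Sum>l\<in>F. \<Sum>u\<in>UNIV. (eigenprojection (laplacian G) l $ u $ u)\<^sup>2)"
  unfolding laziness_eq_sum
  by (rule sum.mono_neutral_left[OF assms]) (simp add: eigenprojection_diag_non_eigenvalue)

section \<open>The Laplacian\<close>

lemma laplacian_mult:
  "(laplacian G *v x) $ u = real (card {w. G u w}) * x $ u - (\<Sum>w | G u w. x $ w)"
proof -
  have "(laplacian G *v x) $ u
      = (\<Sum>w\<in>UNIV. if u = w then real (card {w. G u w}) * x $ w else 0)
        - (\<Sum>w\<in>UNIV. if G u w then x $ w else 0)"
    by (simp add: matrix_vector_mult_def laplacian_def degree_matrix_def adjacency_matrix_def
        left_diff_distrib sum_subtractf if_distrib[of "\<lambda>a. a * _"] cong: if_cong)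
  also have "\<dots> = real (card {w. G u w}) * x $ u - (\<Sum>w | G u w. x $ w)"
    by (simp add: sum.If_cases)
  finally show ?thesis .
qed

lemma one_in_kernel: "laplacian G *v 1 = 0"
  by (simp add: vec_eq_iff laplacian_mult)

text \<open>Maximum principle: a kernel vector averages over neighbours, so where it is maximal all
  neighbours are maximal too, and connectedness spreads this to every vertex.\<close>

lemma eigenspace_0_connected:
  fixes G :: "'v::finite graph"
  assumes "simple_graph G" "connected_graph G"
  shows "eigenspace (laplacian G) 0 = span {1}"
proof
  show "span {1} \<subseteq> eigenspace (laplacian G) 0"
    by (auto simp: span_singleton eigenspace_def matrix_vector_mult_scaleR one_in_kernel)
  show "eigenspace (laplacian G) 0 \<subseteq> span {1}"
  proof
    fix x assume "x \<in> eigenspace (laplacian G) 0"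
    then have harm: "real (card {w. G u w}) * x $ u = (\<Sum>w | G u w. x $ w)" for u
      using laplacian_mult[of G x u] by (simp add: eigenspace_def)
    obtain c where c: "\<And>u. x $ u \<le> x $ c"
      using Max_in[of "range (($) x)"] Max_ge[of "range (($) x)"] by fastforce
    have "x $ u = x $ c" if "G\<^sup>*\<^sup>* c u" for u
      using that
    proof induction
      case (step y z)
      have "(\<Sum>w | G y w. x $ c - x $ w) = 0"
        using harm[of y] step.IH by (simp add: sum_subtractf)
      then show ?case using c step.hyps by (subst (asm) sum_nonneg_eq_0_iff) auto
    qed simp
    then have "x = (x $ c) *\<^sub>R 1"
      using assms(2) by (simp add: vec_eq_iff connected_graph_def)
    then show "x \<in> span {1}" by (metis rangeI span_singleton)
  qed
qed

lemma eigenprojection_0_diag: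
  fixes G :: "'v::finite graph"
  assumes "simple_graph G" "connected_graph G"
  shows "eigenprojection (laplacian G) 0 $ u $ u = 1 / real CARD('v)"
  using eigenprojection_diag_line[OF eigenspace_0_connected[OF assms]]
  by (simp add: inner_vec_def)

lemma zero_eigenvalue: "0 \<in> eigenvalues (laplacian G)"
  unfolding eigenvalues_def using one_in_kernel[of G] by (intro CollectI exI[of _ 1]) simp

section \<open>Graphs with at least three nonzero eigenvalues\<close>

text \<open>The function \<open>s (b - s)\<close> is subadditive on \<open>[0, b]\<close>, also when \<open>b\<close> is split off a sum that
  exceeds it, so the entries \<open>x u\<close> can be merged into copies of \<open>b\<close> and a single remainder.\<close>

lemma sum_concave_merge:
  fixes x :: "'a \<Rightarrow> real"
  assumes "finite F" "\<And>u. u \<in> F \<Longrightarrow> 0 \<le> x u" "\<And>u. u \<in> F \<Longrightarrow> x u \<le> b" "0 \<le> b"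
  shows "\<exists>(j::nat) s. 0 \<le> s \<and> s \<le> b \<and> sum x F = real j * b + s
    \<and> s * (b - s) \<le> (\<Sum>u\<in>F. x u * (b - x u))"
  using assms(1-3)
proof (induction F)
  case empty
  show ?case using assms(4) by (intro exI[of _ 0]) auto
next
  case (insert v F)
  then obtain j :: nat and s where s: "0 \<le> s" "s \<le> b" "sum x F = real j * b + s"
    "s * (b - s) \<le> (\<Sum>u\<in>F. x u * (b - x u))" by auto
  have v: "0 \<le> x v" "x v \<le> b" using insert by auto
  show ?case
  proof (cases "s + x v \<le> b")
    case True
    \<comment> \<open>This product is exactly what merging \<open>s\<close> and \<open>x v\<close>
      into one entry loses.\<close>
    have "0 \<le> 2 * (s * x v)" using s v by simp
    then have "(s + x v) * (b - (s + x v)) \<le> s * (b - s) + x v * (b - x v)"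
      by (simp add: algebra_simps)
    then show ?thesis using insert s v True
      by (intro exI[of _ j] exI[of _ "s + x v"]) auto
  next
    case False
    have "s + x v - b \<le> b" using s v by linarith
    \<comment> \<open>The same accounting when the merged entry overflows: one full copy of
      \<open>b\<close>, which contributes 0, is split off, and this product is the loss.\<close>
    moreover have "0 \<le> 2 * ((b - s) * (b - x v))" using s v by simp
    then have "(s + x v - b) * (b - (s + x v - b)) \<le> s * (b - s) + x v * (b - x v)"
      by (simp add: algebra_simps)
    ultimately show ?thesis using insert.hyps s(3,4) False
      by (intro exI[of _ "Suc j"] exI[of _ "s + x v - b"]) (auto simp: distrib_right)
  qed
qed

text \<open>With \<open>b = 1 - 1 / n\<close>, the gap between \<open>b * k\<close> and the sum of
  squares is the sum of \<open>x u * (b - x u)\<close>. Merging bounds it below by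
  \<open>s * (b - s)\<close>, and integrality of \<open>k\<close> determines the remainder:
  \<open>j = k\<close> and \<open>s = k / n\<close>.\<close>

lemma sum_squares_le_of_integer_sum:
  fixes x :: "'v::finite \<Rightarrow> real" and k :: nat
  defines "n \<equiv> real CARD('v)"
  assumes x: "\<And>u. 0 \<le> x u" "\<And>u. x u \<le> 1 - 1 / n"
    and sum: "(\<Sum>u\<in>UNIV. x u) = real k" and k: "1 \<le> k" "k + 2 \<le> CARD('v)"
  shows "(\<Sum>u\<in>UNIV. (x u)\<^sup>2) \<le> (1 - 1 / n) * real k - (n - 2) / n\<^sup>2"
proof -
  define b where "b = 1 - 1 / n"
  have n: "n > 0" by (simp add: n_def)
  have nb: "n * b = n - 1" using n by (simp add: b_def right_diff_distrib)
  have "0 \<le> b" using x[of undefined] unfolding b_def by linarith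
  then obtain j :: nat and s where s: "0 \<le> s" "s \<le> b" "real k = real j * b + s"
    "s * (b - s) \<le> (\<Sum>u\<in>UNIV. x u * (b - x u))"
    using sum_concave_merge[of UNIV x b] x sum unfolding b_def by auto
  have "n * real k = real j * (n * b) + n * s"
    unfolding s(3) by (simp add: algebra_simps)
  then have ns: "n * s = real k + (n - 1) * (real k - real j)"
    unfolding nb by (simp add: algebra_simps)
  have "0 \<le> n * s" "n * s \<le> n - 1"
    using s n mult_left_mono[OF s(2), of n] by (simp_all add: nb)
  moreover have kn: "1 \<le> real k" "real k + 2 \<le> n" using k by (simp_all add: n_def)
  \<comment> \<open>Both \<open>n * s\<close> in \<open>[0, n - 1]\<close> and \<open>k\<close> in
    \<open>[1, n - 2]\<close> enter here; their difference \<open>(n - 1) * (k - j)\<close> is then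
    too small for a nonzero integer \<open>k - j\<close>.\<close>
  ultimately have "- (n - 1) < (n - 1) * (real k - real j)"
    "(n - 1) * (real k - real j) < n - 1"
    using ns by linarith+
  then have "(n - 1) * (- 1) < (n - 1) * (real k - real j)"
    "(n - 1) * (real k - real j) < (n - 1) * 1" by simp_all
  moreover have "n - 1 > 0" using kn by simp
  ultimately have "- 1 < real k - real j" "real k - real j < 1"
    using mult_less_cancel_left_pos by blast+
  then have "j = k" by linarith
  then have s_eq: "s = real k / n" using ns n by (simp add: field_simps)
  \<comment> \<open>The concave function \<open>k * (n - 1 - k)\<close> takes its minimum
    \<open>n - 2\<close> at the ends \<open>k = 1\<close> and \<open>k = n - 2\<close>; this product
    is the excess over it.\<close>
  have "0 \<le> (real k - 1) * (n - 2 - real k)" using kn by simp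
  then have "n - 2 \<le> real k * (n - 1 - real k)" by (simp add: algebra_simps)
  then have "(n - 2) / n\<^sup>2 \<le> real k * (n - 1 - real k) / n\<^sup>2" by (simp add: divide_right_mono)
  also have "\<dots> = s * (b - s)"
    using n by (simp add: s_eq b_def power2_eq_square field_simps)
  also have "\<dots> \<le> b * real k - (\<Sum>u\<in>UNIV. (x u)\<^sup>2)"
    using s(4) by (simp add: right_diff_distrib sum_subtractf power2_eq_square
        sum mult.commute[of _ b] flip: sum_distrib_left)
  finally show ?thesis by (simp add: b_def)
qed

lemma laziness_le_of_three_nonzero_eigenvalues:
  fixes G :: "'v::finite graph"
  defines "n \<equiv> real CARD('v)"
  assumes G: "simple_graph G" "connected_graph G"
    and three: "3 \<le> card (eigenvalues (laplacian G) - {0})"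
  shows "laziness G \<le> 1 / n + (n - 1)\<^sup>2 / n - 3 * (n - 2) / n\<^sup>2"
proof -
  let ?L = "laplacian G"
  let ?E = "eigenvalues ?L - {0}"
  define p where "p l u = eigenprojection ?L l $ u $ u" for l u
  define d where "d l = dim (eigenspace ?L l)" for l
  note sym = transpose_laplacian[OF G(1)]
  have fin: "finite (eigenvalues ?L)" by (rule finite_eigenvalues[OF sym])
  have n: "n > 0" by (simp add: n_def)
  have p0: "p 0 u = 1 / n" for u
    unfolding p_def n_def by (rule eigenprojection_0_diag[OF G])
  have nonneg: "0 \<le> p l u" for l u by (simp add: p_def eigenprojection_diag_nonneg)
  have sum1: "(\<Sum>l\<in>?E. p l u) = 1 - 1 / n" for u
    using eigenprojection_diag_sum[OF sym, of u] sum.remove[OF fin zero_eigenvalue, of "\<lambda>l. p l u"] p0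
    by (simp add: p_def)
  \<comment> \<open>Eigenvalue 0 already takes \<open>1 / n\<close> of the unit total at
    \<open>u\<close>.\<close>
  have le: "p l u \<le> 1 - 1 / n" if "l \<in> ?E" for l u
    unfolding sum1[of u, symmetric] using that fin nonneg by (intro member_le_sum) auto
  have tr: "(\<Sum>u\<in>UNIV. p l u) = real (d l)" for l
    by (simp add: p_def d_def trace_eigenprojection)
  have "real (\<Sum>l\<in>?E. d l) = (\<Sum>u\<in>(UNIV::'v set). 1 - 1 / n)"
    unfolding of_nat_sum tr[symmetric] by (subst sum.swap) (simp only: sum1)
  also have "\<dots> = n - 1" using n by (simp add: n_def right_diff_distrib)
  finally have dsum: "real (\<Sum>l\<in>?E. d l) = n - 1" .
  have pos: "1 \<le> d l" if "l \<in> ?E" for l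
    using dim_eigenspace_pos[of l ?L] that by (simp add: d_def)
  \<comment> \<open>At least two other nonzero eigenvalues each take a dimension out of the total
    \<open>n - 1\<close>.\<close>
  have dle: "d l + 2 \<le> CARD('v)" if l: "l \<in> ?E" for l
  proof -
    have "card (?E - {l}) \<ge> 2" using three l fin by simp
    moreover have "(\<Sum>m\<in>?E - {l}. 1) \<le> (\<Sum>m\<in>?E - {l}. d m)" by (intro sum_mono pos) auto
    ultimately have "d l + 2 \<le> (\<Sum>m\<in>?E. d m)"
      using sum.remove[of ?E l d] l fin by simp
    then show ?thesis using dsum unfolding n_def by linarith
  qed
  have n2: "n \<ge> 2"
  proof -
    obtain l where "l \<in> ?E" using three by (metis card.empty ex_in_conv not_numeral_le_zero)
    then show ?thesis using dle[of l] by (simp add: n_def)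
  qed
  have "laziness G = (\<Sum>u\<in>UNIV. (p 0 u)\<^sup>2) + (\<Sum>l\<in>?E. \<Sum>u\<in>UNIV. (p l u)\<^sup>2)"
    unfolding laziness_eq_sum p_def using sum.remove[OF fin zero_eigenvalue] by simp
  also have "(\<Sum>u\<in>UNIV. (p 0 u)\<^sup>2) = 1 / n"
    using n by (simp add: p0 power2_eq_square flip: n_def)
  also have "(\<Sum>l\<in>?E. \<Sum>u\<in>UNIV. (p l u)\<^sup>2)
      \<le> (\<Sum>l\<in>?E. (1 - 1 / n) * real (d l) - (n - 2) / n\<^sup>2)"
    unfolding n_def
    by (intro sum_mono sum_squares_le_of_integer_sum)
      (use nonneg le tr pos dle in \<open>auto simp: n_def\<close>)
  also have "\<dots> = (1 - 1 / n) * (n - 1) - real (card ?E) * ((n - 2) / n\<^sup>2)"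
    by (simp add: sum_subtractf dsum[symmetric] flip: sum_distrib_left)
  also have "\<dots> \<le> (1 - 1 / n) * (n - 1) - 3 * ((n - 2) / n\<^sup>2)"
    using three n2 by (intro diff_left_mono mult_right_mono) auto
  finally show ?thesis using n by (simp add: field_simps power2_eq_square)
qed

section \<open>Distance three forces three nonzero eigenvalues\<close>

text \<open>The polynomial \<open>t (t - a) (t - b)\<close> vanishes at every eigenvalue, hence
  annihilates \<open>A\<close>; this is checked on each eigencomponent of \<open>x\<close>.\<close>

lemma cubic_relation:
  fixes A :: "real^'v::finite^'v"
  assumes sym: "transpose A = A" and ev: "eigenvalues A \<subseteq> {0, a, b}"
  shows "A *v (A *v (A *v x)) = (a + b) *\<^sub>R (A *v (A *v x)) - (a * b) *\<^sub>R (A *v x)"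
proof -
  define P where "P l = eigenprojection A l *v x" for l
  have P: "A *v P l = l *\<^sub>R P l" for l
    using orth_proj_works[OF subspace_eigenspace, of A l x]
    by (simp add: P_def eigenprojection_mult eigenspace_def)
  have step: "A *v (\<Sum>l\<in>eigenvalues A. c l *\<^sub>R P l) = (\<Sum>l\<in>eigenvalues A. (c l * l) *\<^sub>R P l)" for c
    by (simp add: linear_sum[OF matrix_vector_mul_linear] matrix_vector_mult_scaleR P)
  \<comment> \<open>The explicit coefficient 1 gives the sum the shape that \<open>step\<close>
    rewrites, here and in the two later applications.\<close>
  have x: "x = (\<Sum>l\<in>eigenvalues A. 1 *\<^sub>R P l)"
    by (simp add: P_def eigenprojections_sum[OF sym])
  have A1: "A *v x = (\<Sum>l\<in>eigenvalues A. (1 * l) *\<^sub>R P l)" by (subst x) (rule step)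
  have A2: "A *v (A *v x) = (\<Sum>l\<in>eigenvalues A. (1 * l * l) *\<^sub>R P l)" unfolding A1 by (rule step)
  have A3: "A *v (A *v (A *v x)) = (\<Sum>l\<in>eigenvalues A. (1 * l * l * l) *\<^sub>R P l)"
    unfolding A2 by (rule step)
  have "1 * l * l * l = (a + b) * (1 * l * l) - (a * b) * (1 * l)" if "l \<in> eigenvalues A" for l
    using ev that by (auto simp: algebra_simps)
  then show ?thesis unfolding A3 unfolding A2 unfolding A1 scaleR_sum_right
    by (simp only: scaleR_scaleR scaleR_left_diff_distrib flip: sum_subtractf cong: sum.cong)
qed

definition within_two :: "'v graph \<Rightarrow> 'v \<Rightarrow> 'v \<Rightarrow> bool" where
  "within_two G u v \<longleftrightarrow> u = v \<or> G u v \<or> (\<exists>w. G u w \<and> G w v)"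

lemma distance_three_obtains:
  assumes "connected_graph G" "\<not> within_two G u v"
  obtains a x y where "G u a" "G a x" "G x y" "\<not> within_two G u y"
proof -
  have "G\<^sup>*\<^sup>* u v" using assms(1) by (simp add: connected_graph_def)
  \<comment> \<open>A walk from \<open>u\<close> either stays in the ball of radius two or has an
    edge leaving it; the inner end \<open>x\<close> of such an edge must be joined to
    \<open>u\<close> by two edges.\<close>
  then have "within_two G u v \<or> (\<exists>x y. within_two G u x \<and> G x y \<and> \<not> within_two G u y)"
    by induction (auto simp: within_two_def)
  then obtain x y where "within_two G u x" "G x y" "\<not> within_two G u y" using assms(2) by blast
  then show thesis using that by (auto simp: within_two_def)
qed

text \<open>With at most two nonzero eigenvalues, the cube of the Laplacian would combine its square
  and itself. At two vertices at distance three, the entries of the latter two vanish, while that of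
  the cube is minus the number of walks of length three.\<close>

lemma three_nonzero_eigenvalues:
  fixes G :: "'v::finite graph"
  assumes G: "simple_graph G" "connected_graph G" and far: "\<not> within_two G u v"
  shows "3 \<le> card (eigenvalues (laplacian G) - {0})"
proof (rule ccontr)
  let ?L = "laplacian G"
  note sym = transpose_laplacian[OF G(1)]
  assume "\<not> ?thesis"
  then have "card (eigenvalues ?L - {0}) \<le> 2" by simp
  moreover have "finite (eigenvalues ?L - {0})" using finite_eigenvalues[OF sym] by simp
  ultimately have "\<exists>a b. eigenvalues ?L - {0} \<subseteq> {a, b}"
    by (metis card_2_iff card_le_Suc0_iff_eq One_nat_def Suc_1 le_SucE order_refl insertCI
        subsetI)
  then obtain a b where "eigenvalues ?L \<subseteq> {0, a, b}" by blast
  note cubic = cubic_relation[OF sym this]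
  obtain s x y where path: "G u s" "G s x" "G x y" and uy: "\<not> within_two G u y"
    using distance_three_obtains[OF G(2) far] .
  have Gsym: "G p q \<longleftrightarrow> G q p" for p q using G(1) by (auto simp: simple_graph_def dest: sympD)
  \<comment> \<open>Applying powers of the Laplacian to \<open>e\<close> reads off their column at
    \<open>y\<close>.\<close>
  define e where "e = axis y (1::real)"
  have L1: "(?L *v e) $ w = - (if G w y then 1 else 0)" if "w \<noteq> y" for w
    using that by (simp add: laplacian_mult e_def axis_def sum.If_cases)
  \<comment> \<open>Counts walks of length two: the degree term vanishes by \<open>L1\<close> at
    \<open>w\<close>, and no neighbour of \<open>w\<close> is \<open>y\<close>, so \<open>L1\<close>
    applies to all of them.\<close>
  have L2: "(?L *v (?L *v e)) $ w = real (card {t. G w t \<and> G t y})" if "w \<noteq> y" "\<not> G w y" for w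
  proof -
    have "(\<Sum>t | G w t. (?L *v e) $ t) = (\<Sum>t | G w t. - (if G t y then 1 else 0))"
      using that by (intro sum.cong refl L1) auto
    then show ?thesis
      using that by (subst laplacian_mult) (simp add: L1 sum_negf sum.If_cases Collect_conj_eq)
  qed
  have u: "u \<noteq> y" "\<not> G u y" "\<And>t. G u t \<Longrightarrow> t \<noteq> y \<and> \<not> G t y"
    using uy by (auto simp: within_two_def)
  have u2: "(?L *v (?L *v e)) $ u = 0" using u by (auto simp: L2)
  have "(?L *v (?L *v (?L *v e))) $ u = - (\<Sum>t | G u t. (?L *v (?L *v e)) $ t)"
    by (subst laplacian_mult) (simp add: u2)
  also have "\<dots> = - (\<Sum>t | G u t. real (card {r. G t r \<and> G r y}))"
    using u(3) by (simp add: L2)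
  also have "\<dots> < 0"
  proof -
    have "0 < real (card {r. G s r \<and> G r y})" using path by (auto simp: card_gt_0_iff)
    then have "0 < (\<Sum>t | G u t. real (card {r. G t r \<and> G r y}))"
      using path by (intro sum_pos2[of _ s]) auto
    then show ?thesis by simp
  qed
  finally show False using cubic[of e] u u2 by (simp add: L1)
qed

section \<open>Stars\<close>

lemma simple_graph_star: "simple_graph (star c)"
  by (auto simp: simple_graph_def star_def symp_def irreflp_def)

lemma connected_graph_star: "connected_graph (star c)"
proof -
  have "(star c)\<^sup>*\<^sup>* u c" "(star c)\<^sup>*\<^sup>* c u" for u
    by (cases "u = c"; auto simp: star_def intro: r_into_rtranclp)+
  then show ?thesis unfolding connected_graph_def by (meson rtranclp_trans)
qed

lemma laplacian_star_center:
  fixes c :: "'v::finite"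
  shows "(laplacian (star c) *v x) $ c = real CARD('v) * x $ c - (\<Sum>w\<in>UNIV. x $ w)"
proof -
  have N: "{w. star c c w} = UNIV - {c}" by (auto simp: star_def)
  have "real (card (UNIV - {c})) = real CARD('v) - 1"
    by (simp add: card_Diff_singleton of_nat_diff Suc_leI)
  then show ?thesis
    unfolding laplacian_mult N by (simp add: sum_diff1 left_diff_distrib)
qed

lemma laplacian_star_leaf:
  assumes "u \<noteq> c"
  shows "(laplacian (star c) *v x) $ u = x $ u - x $ c"
proof -
  have N: "{w. star c u w} = {c}" using assms by (auto simp: star_def)
  show ?thesis unfolding laplacian_mult N by simp
qed

text \<open>For \<open>l \<noteq> 1\<close> the leaf equations give all leaves one value
  \<open>t\<close> and the centre \<open>(1 - l) * t\<close>. The centre equation becomes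
  \<open>l * t * (l - n) = 0\<close>, so a nonzero vector forces \<open>l = n\<close>, where the
  centre value is \<open>(1 - n) * t\<close>.\<close>

lemma eigenspace_star_off_1:
  fixes c :: "'v::finite"
  assumes "x \<in> eigenspace (laplacian (star c)) l" "l \<noteq> 1" "l \<noteq> 0" "CARD('v) \<ge> 2"
  shows "\<exists>t. x = t *\<^sub>R (\<chi> u. if u = c then 1 - real CARD('v) else 1)"
    and "x \<noteq> 0 \<Longrightarrow> l = real CARD('v)"
proof -
  have ev: "(laplacian (star c) *v x) $ u = l * x $ u" for u
    using assms(1) by (simp add: eigenspace_def)
  let ?n = "real CARD('v)"
  have leaf: "(1 - l) * x $ u = x $ c" if "u \<noteq> c" for u
    using ev[of u] laplacian_star_leaf[OF that, of x] by (simp add: algebra_simps)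
  define t where "t = x $ c / (1 - l)"
  have xt: "x $ u = t" if "u \<noteq> c" for u
    using leaf[OF that] assms(2) by (simp add: t_def field_simps)
  have xc: "x $ c = (1 - l) * t" using assms(2) by (simp add: t_def)
  have "(\<Sum>w\<in>UNIV. x $ w) = x $ c + (\<Sum>w\<in>UNIV - {c}. x $ w)"
    by (simp add: sum.remove)
  also have "(\<Sum>w\<in>UNIV - {c}. x $ w) = (?n - 1) * t"
    by (simp add: xt card_Diff_singleton of_nat_diff Suc_leI)
  finally have "l * x $ c = ?n * x $ c - (x $ c + (?n - 1) * t)"
    using ev[of c] laplacian_star_center[of c x] by simp
  then have "l * t * (l - ?n) = 0" unfolding xc by (simp only: algebra_simps)
  then have or: "t = 0 \<or> l = ?n" using assms(3) by auto
  then show "\<exists>t. x = t *\<^sub>R (\<chi> u. if u = c then 1 - ?n else 1)"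
    by (intro exI[of _ t]) (auto simp: vec_eq_iff xt xc)
  show "l = ?n" if "x \<noteq> 0"
  proof (rule ccontr)
    assume "l \<noteq> ?n"
    then have "t = 0" using or by simp
    then have "x $ u = 0" for u using xt xc by (cases "u = c") auto
    then show False using that by (simp add: vec_eq_iff)
  qed
qed

text \<open>The projections at 0 and \<open>n\<close> have rank one and are explicit; the diagonal
  at 1 is what they leave of the identity, so its eigenspace need not be described.\<close>

lemma laziness_star:
  fixes c :: "'v::finite"
  defines "n \<equiv> real CARD('v)"
  assumes two: "CARD('v) \<ge> 2"
  shows "laziness (star c) = 1 / n + (n - 1)\<^sup>2 / n - 2 * (n - 2) / (n * (n - 1))"
proof -
  let ?L = "laplacian (star c)"
  define p where "p l u = eigenprojection ?L l $ u $ u" for l u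
  define z :: "real^'v" where "z = (\<chi> u. if u = c then 1 - n else 1)"
  note sym = transpose_laplacian[OF simple_graph_star, of c]
  have n: "n \<ge> 2" using two by (simp add: n_def)
  have card: "real (card (UNIV - {c})) = n - 1"
    by (simp add: n_def card_Diff_singleton of_nat_diff Suc_leI)
  have sum_split: "(\<Sum>u\<in>UNIV. f u) = f c + (n - 1) * r" if "\<And>u. u \<noteq> c \<Longrightarrow> f u = r" for f :: "'v \<Rightarrow> real" and r
  proof -
    have "(\<Sum>u\<in>UNIV - {c}. f u) = (n - 1) * r" using that card by simp
    then show ?thesis by (simp add: sum.remove[of UNIV c])
  qed
  have sub: "eigenvalues ?L \<subseteq> {0, 1, n}"
    using eigenspace_star_off_1(2)[OF _ _ _ two, of _ c]
    by (auto simp: eigenvalues_def eigenspace_def n_def)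
  have "z \<in> eigenspace ?L n"
  proof -
    have "(\<Sum>u\<in>UNIV. z $ u) = 0"
      by (subst sum_split[where r = 1]) (auto simp: z_def)
    then have "(?L *v z) $ u = n * z $ u" for u
      by (cases "u = c") (simp_all add: laplacian_star_center laplacian_star_leaf z_def n_def)
    then show ?thesis by (simp add: eigenspace_def vec_eq_iff)
  qed
  then have "span {z} \<subseteq> eigenspace ?L n"
    by (simp add: span_minimal subspace_eigenspace)
  moreover have "eigenspace ?L n \<subseteq> span {z}"
    using eigenspace_star_off_1(1)[OF _ _ _ two, of _ c n] n
    unfolding span_singleton z_def n_def by fastforce
  ultimately have "eigenspace ?L n = span {z}" by (rule subset_antisym[rotated])
  moreover have "z \<noteq> 0" using n by (auto simp: z_def vec_eq_iff)
  moreover have "z \<bullet> z = n * (n - 1)"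
    unfolding inner_vec_def by (subst sum_split[where r = 1]) (auto simp: z_def algebra_simps)
  ultimately have pn: "p n u = (z $ u)\<^sup>2 / (n * (n - 1))" for u
    unfolding p_def using eigenprojection_diag_line by metis
  have p0: "p 0 u = 1 / n" for u
    unfolding p_def n_def by (rule eigenprojection_0_diag[OF simple_graph_star connected_graph_star])
  \<comment> \<open>This also covers \<open>n = 2\<close>, where 1 is no eigenvalue and its diagonal
    entries are 0.\<close>
  have "(\<Sum>l\<in>{0, 1, n}. p l u) = 1" for u
  proof -
    have "(\<Sum>l\<in>{0, 1, n}. p l u) = (\<Sum>l\<in>eigenvalues ?L. p l u)"
      using sub by (intro sum.mono_neutral_right) (auto simp: p_def eigenprojection_diag_non_eigenvalue)
    then show ?thesis using eigenprojection_diag_sum[OF sym, of u] by (simp add: p_def)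
  qed
  then have "p 0 u + (p 1 u + p n u) = 1" for u using n by simp
  then have p1: "p 1 u = 1 - 1 / n - p n u" for u using p0 by (simp add: eq_diff_eq add_ac)
  have nc: "p n c = (n - 1) / n" using n by (simp add: pn z_def power2_eq_square field_simps)
  have p1c: "p 1 c = 0" using n by (simp add: p1 nc field_simps)
  have nl: "p n u = 1 / (n * (n - 1))" if "u \<noteq> c" for u using that by (simp add: pn z_def)
  have "laziness (star c) = (\<Sum>l\<in>{0, 1, n}. \<Sum>u\<in>UNIV. (p l u)\<^sup>2)"
    unfolding p_def by (rule laziness_eq_sum_superset[OF _ sub]) simp
  also have "\<dots> = (\<Sum>u\<in>UNIV. (p 0 u)\<^sup>2 + (p 1 u)\<^sup>2 + (p n u)\<^sup>2)"
    using n by (simp add: sum.distrib)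
  also have "\<dots> = ((1 / n)\<^sup>2 + ((n - 1) / n)\<^sup>2)
      + (n - 1) * ((1 / n)\<^sup>2 + (1 - 1 / n - 1 / (n * (n - 1)))\<^sup>2 + (1 / (n * (n - 1)))\<^sup>2)"
    by (subst sum_split[where r = "(1 / n)\<^sup>2 + (1 - 1 / n - 1 / (n * (n - 1)))\<^sup>2
        + (1 / (n * (n - 1)))\<^sup>2"]) (simp_all add: p0 p1c nc, simp add: p1 nl)
  also have "\<dots> = 1 / n + (n - 1)\<^sup>2 / n - 2 * (n - 2) / (n * (n - 1))"
  proof -
    \<comment> \<open>In terms of \<open>m\<close> both denominators, \<open>m\<close> and
      \<open>m + 1\<close>, are visibly positive and can be cleared.\<close>
    define m where "m = n - 1"
    have "m > 0" "n = m + 1" using n by (auto simp: m_def)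
    then show ?thesis by (simp add: divide_simps power2_eq_square) (simp add: algebra_simps)
  qed
  finally show ?thesis .
qed

text \<open>Covers the size that \<open>laziness_star\<close> excludes: eigenvalue 0 alone exhausts
  the unit diagonal.\<close>

lemma laziness_single_vertex:
  fixes G :: "'v::finite graph"
  assumes G: "simple_graph G" "connected_graph G" and one: "CARD('v) = 1"
  shows "laziness G = 1"
proof -
  let ?L = "laplacian G"
  note sym = transpose_laplacian[OF G(1)]
  have p0: "eigenprojection ?L 0 $ u $ u = 1" for u
    using eigenprojection_0_diag[OF G, of u] one by simp
  have "eigenprojection ?L l $ u $ u = 0" if "l \<noteq> 0" "l \<in> eigenvalues ?L" for l u
  proof -
    have "(\<Sum>l\<in>eigenvalues ?L - {0}. eigenprojection ?L l $ u $ u) = 0"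
      using eigenprojection_diag_sum[OF sym, of u] p0[of u]
        sum.remove[OF finite_eigenvalues[OF sym] zero_eigenvalue, of "\<lambda>l. eigenprojection ?L l $ u $ u"]
      by simp
    then show ?thesis
      using that finite_eigenvalues[OF sym]
      by (subst (asm) sum_nonneg_eq_0_iff) (auto simp: eigenprojection_diag_nonneg)
  qed
  then have "laziness G = (\<Sum>l\<in>{0}. \<Sum>u\<in>UNIV. (eigenprojection ?L l $ u $ u)\<^sup>2)"
    unfolding laziness_eq_sum
    by (intro sum.mono_neutral_right) (auto simp: finite_eigenvalues[OF sym] zero_eigenvalue)
  then show ?thesis using one by (simp add: p0)
qed

lemma laziness_star_eq:
  fixes c :: "'v::finite" and d :: "'w::finite"
  assumes "CARD('v) = CARD('w)"
  shows "laziness (star c) = laziness (star d)"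
proof (cases "CARD('v) \<ge> 2")
  case True
  then show ?thesis using laziness_star[of c] laziness_star[of d] assms by simp
next
  case False
  moreover have "CARD('v) > 0" by simp
  ultimately have "CARD('v) = 1" by linarith
  then show ?thesis
    using assms laziness_single_vertex[OF simple_graph_star connected_graph_star] by metis
qed

lemma graph_iso_star:
  fixes c :: "'w::finite" and G :: "'v::finite graph"
  assumes "CARD('v) = CARD('w)"
  shows "graph_iso G (star c) \<longleftrightarrow> (\<exists>d. G = star d)"
proof
  assume "graph_iso G (star c)"
  then obtain f where f: "bij f" "\<And>u v. G u v \<longleftrightarrow> star c (f u) (f v)"
    by (auto simp: graph_iso_def)
  have "G = star (inv f c)"
  proof (intro ext)
    fix u v
    show "G u v = star (inv f c) u v"
      using f(1) unfolding f(2) star_def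
      by (metis bij_is_inj bij_is_surj inj_eq inv_f_f surj_f_inv_f)
  qed
  then show "\<exists>d. G = star d" by blast
next
  assume "\<exists>d. G = star d"
  then obtain d where d: "G = star d" by blast
  obtain h :: "'v \<Rightarrow> 'w" where h: "bij h"
    using finite_same_card_bij[of "UNIV::'v set" "UNIV::'w set"] assms by auto
  \<comment> \<open>An arbitrary bijection, corrected by a swap so that centre goes to
    centre.\<close>
  define f where "f = Transposition.transpose (h d) c \<circ> h"
  have "bij f" unfolding f_def using h by (intro bij_comp) auto
  moreover have "f d = c" by (simp add: f_def)
  ultimately show "graph_iso G (star c)"
    unfolding graph_iso_def d star_def by (metis bij_is_inj inj_eq)
qed

section \<open>Trees of diameter at most two\<close>

lemma tree_no_short_cycles:
  assumes "is_tree G"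
  shows "\<not> (G a b \<and> G b c \<and> G c a)"
    and "distinct [a, b, c, d] \<Longrightarrow> \<not> (G a b \<and> G b c \<and> G c d \<and> G d a)"
    and "distinct [a, b, c, d, e] \<Longrightarrow> \<not> (G a b \<and> G b c \<and> G c d \<and> G d e \<and> G e a)"
proof -
  have no: "\<not> is_cycle G p" for p using assms by (auto simp: is_tree_def)
  have irr: "\<not> G u u" for u using assms by (auto simp: is_tree_def simple_graph_def irreflp_def)
  show "\<not> (G a b \<and> G b c \<and> G c a)"
    using no[of "[a, b, c]"] irr by (auto simp: is_cycle_def)
  show "distinct [a, b, c, d] \<Longrightarrow> \<not> (G a b \<and> G b c \<and> G c d \<and> G d a)"
    using no[of "[a, b, c, d]"] by (auto simp: is_cycle_def)
  show "distinct [a, b, c, d, e] \<Longrightarrow> \<not> (G a b \<and> G b c \<and> G c d \<and> G d e \<and> G e a)"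
    using no[of "[a, b, c, d, e]"] by (auto simp: is_cycle_def)
qed

text \<open>A vertex \<open>c\<close> with two neighbours is adjacent to all others: a vertex
  \<open>w\<close> behind a neighbour \<open>d\<close> would be within two of another neighbour
  \<open>e\<close>, closing a cycle of length four or five (or a triangle). If no such
  \<open>c\<close> exists, all degrees are at most one.\<close>

lemma tree_diameter_two_is_star:
  fixes G :: "'v graph"
  assumes tree: "is_tree G" and two: "\<And>u v. within_two G u v"
  shows "\<exists>c. G = star c"
proof -
  have sym: "G u v \<Longrightarrow> G v u" and irr: "\<not> G u u" for u v
    using tree by (auto simp: is_tree_def simple_graph_def irreflp_def dest: sympD)
  note cycles = tree_no_short_cycles[OF tree]
  show ?thesis
  proof (cases "\<exists>c a b. G c a \<and> G c b \<and> a \<noteq> b")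
    case True
    then obtain c a b where c: "G c a" "G c b" "a \<noteq> b" by blast
    have all: "G c w" if "w \<noteq> c" for w
    proof (rule ccontr)
      assume nw: "\<not> G c w"
      then obtain d where d: "G c d" "G d w" using two[of c w] \<open>w \<noteq> c\<close> by (auto simp: within_two_def)
      obtain e where e: "G c e" "e \<noteq> d" using c by metis
      have "e \<noteq> w" "e \<noteq> c" "d \<noteq> c" "d \<noteq> w" using nw e d irr by auto
      then consider "G e w" | z where "G e z" "G z w" using two[of e w] by (auto simp: within_two_def)
      then show False
      proof cases
        case 1
        then show False
          using cycles(2)[of c d w e] d e sym \<open>e \<noteq> w\<close> \<open>e \<noteq> c\<close> \<open>d \<noteq> c\<close> \<open>d \<noteq> w\<close> that by auto
      next
        case 2
        have "z \<noteq> c" using 2 nw by auto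
        moreover have "z \<noteq> d" using 2 cycles(1)[of c d e] d e sym by auto
        moreover have "z \<noteq> w" "z \<noteq> e" using 2 irr by auto
        ultimately show False
          using cycles(3)[of c d w z e] 2 d e sym \<open>e \<noteq> w\<close> \<open>e \<noteq> c\<close> \<open>d \<noteq> c\<close> \<open>d \<noteq> w\<close> that by auto
      qed
    qed
    have "G u v = star c u v" for u v
      using all sym irr cycles(1)[of c u v] unfolding star_def by metis
    then show ?thesis by blast
  next
    case False
    then have deg: "G c a \<Longrightarrow> G c b \<Longrightarrow> a = b" for a b c by blast
    \<comment> \<open>A middle vertex between \<open>u\<close> and \<open>v\<close> would have two
      distinct neighbours. Completeness with degrees at most one leaves no third vertex, so any
      centre will do.\<close>
    have complete: "G u v" if "u \<noteq> v" for u v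
      using two[of u v] that deg sym unfolding within_two_def by metis
    have "G u v = star c u v" for c u v
      using complete deg irr unfolding star_def by metis
    then show ?thesis by blast
  qed
qed

section \<open>Comparison with the star\<close>

text \<open>A path of length three gives four vertices, and \<open>2 / (n - 1) < 3 / n\<close> holds
  exactly from \<open>n = 4\<close> on (the two sides agree at \<open>n = 3\<close>), so the loss
  exceeds that of the star.\<close>

lemma laziness_less_star:
  fixes G :: "'v::finite graph" and c :: 'v
  assumes G: "simple_graph G" "connected_graph G" and far: "\<not> within_two G u v"
  shows "laziness G < laziness (star c)"
proof -
  define n where "n = real CARD('v)"
  obtain s x y where path: "G u s" "G s x" "G x y" and uy: "\<not> within_two G u y"
    using distance_three_obtains[OF G(2) far] .
  have irr: "\<not> G w w" for w using G(1) by (auto simp: simple_graph_def irreflp_def)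
  have "card {u, s, x, y} = 4"
  proof -
    have "distinct [u, s, x, y]" using path uy irr by (auto simp: within_two_def)
    then show ?thesis by simp
  qed
  then have n4: "CARD('v) \<ge> 4" using card_mono[of UNIV "{u, s, x, y}"] by simp
  then have n: "n \<ge> 4" by (simp add: n_def)
  have "2 * (n - 2) / (n * (n - 1)) < 3 * (n - 2) / n\<^sup>2"
  proof -
    have "(n - 2) / n * (2 / (n - 1)) < (n - 2) / n * (3 / n)"
      using n by (intro mult_strict_left_mono) (auto simp: field_simps)
    then show ?thesis by (simp add: power2_eq_square mult_ac)
  qed
  then show ?thesis
    using laziness_le_of_three_nonzero_eigenvalues[OF G three_nonzero_eigenvalues[OF G far]]
      laziness_star[of c] n4 by (simp add: n_def)
qed

theorem corollary3p3:
  fixes T :: "'v::finite graph" and c :: "'w::finite" and n :: nat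
  assumes "is_tree T"
    and "CARD('v) = n"
    and "CARD('w) = n"
  shows "laziness T \<le> laziness (star c)
    \<and> (laziness T = laziness (star c) \<longleftrightarrow> graph_iso T (star c))"
proof (cases "\<forall>u v. within_two T u v")
  case True
  then obtain d where "T = star d" using tree_diameter_two_is_star[OF assms(1)] by blast
  then show ?thesis using graph_iso_star[of T c] laziness_star_eq[of d c] assms(2,3) by auto
next
  case False
  then obtain u v where far: "\<not> within_two T u v" by blast
  have "simple_graph T" "connected_graph T" using assms(1) by (auto simp: is_tree_def)
  then have less: "laziness T < laziness (star d)" for d :: 'v
    by (rule laziness_less_star[OF _ _ far])
  have card: "CARD('v) = CARD('w)" using assms by simp
  have "laziness T < laziness (star c)"
    using less laziness_star_eq[OF card] by metis
  \<comment> \<open>If \<open>T\<close> were a star on its own vertex type, \<open>less\<close> at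
    its centre would put its laziness below itself.\<close>
  moreover have "\<not> graph_iso T (star c)"
    unfolding graph_iso_star[OF card] using less by blast
  ultimately show ?thesis by simp
qed

end
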